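(* Let $R$ be a ring in which $2$ is a unit. Then a proper ideal of $R$ is quasi sdf-absorbing if and only if it is quasi-primary.
   Context: All rings are commutative with identity. An ideal $I$ of a ring $R$ is called sdf-absorbing if for all non-zero $a,b\in R$, $a^{2}-b^{2}\in I$ implies $a-b\in I$ or $a+b\in I$. A proper ideal $I$ of $R$ is called quasi sdf-absorbing if its radical $\sqrt{I}$ is an sdf-absorbing ideal of $R$. A proper ideal is called quasi-primary if its radical is a prime ideal. *)

theory Defs
  imports "HOL-Algebra.Ideal"
begin

definition proper_ideal :: "'a set \<Rightarrow> ('a, 'b) ring_scheme \<Rightarrow> bool" where
  "proper_ideal I R \<longleftrightarrow> ideal I R \<and> I \<noteq> carrier R"

definition radical_ideal :: "('a, 'b) ring_scheme \<Rightarrow> 'a set \<Rightarrow> 'a set" where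
  "radical_ideal R I = {x \<in> carrier R. \<exists>n::nat. 0 < n \<and> x [^]\<^bsub>R\<^esub> n \<in> I}"

definition sdf_absorbing :: "'a set \<Rightarrow> ('a, 'b) ring_scheme \<Rightarrow> bool" where
  "sdf_absorbing I R \<longleftrightarrow>
     ideal I R \<and>
     (\<forall>a \<in> carrier R - {\<zero>\<^bsub>R\<^esub>}. \<forall>b \<in> carrier R - {\<zero>\<^bsub>R\<^esub>}.
        a [^]\<^bsub>R\<^esub> (2::nat) \<ominus>\<^bsub>R\<^esub> b [^]\<^bsub>R\<^esub> (2::nat) \<in> I
          \<longrightarrow> a \<ominus>\<^bsub>R\<^esub> b \<in> I \<or> a \<oplus>\<^bsub>R\<^esub> b \<in> I)"

definition quasi_sdf_absorbing :: "'a set \<Rightarrow> ('a, 'b) ring_scheme \<Rightarrow> bool" where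
  "quasi_sdf_absorbing I R \<longleftrightarrow> proper_ideal I R \<and> sdf_absorbing (radical_ideal R I) R"

definition quasi_primary :: "'a set \<Rightarrow> ('a, 'b) ring_scheme \<Rightarrow> bool" where
  "quasi_primary I R \<longleftrightarrow> proper_ideal I R \<and> primeideal (radical_ideal R I) R"

end

theory Submission
  imports Defs
begin

text \<open>
  If \<open>2\<close> is a unit, every product is a difference of squares, \<open>x y = a\<^sup>2 - b\<^sup>2\<close> with
  \<open>a = (x + y)/2\<close> and \<open>b = (x - y)/2\<close>, where \<open>a + b = x\<close> and \<open>a - b = y\<close>. So being sdf-absorbing
  amounts to being prime, except that the sdf condition is silent when \<open>a = 0\<close> or \<open>b = 0\<close>;
  then \<open>x = \<plusminus>y\<close>, and \<open>x\<^sup>2\<close> lies in the ideal, which settles the matter for a radical ideal.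
\<close>

lemma (in cring) diff_squares:
  assumes "a \<in> carrier R" "b \<in> carrier R"
  shows "a [^] (2::nat) \<ominus> b [^] (2::nat) = (a \<ominus> b) \<otimes> (a \<oplus> b)"
proof -
  \<comment> \<open>The mixed terms stay visible here; \<open>r_neg\<close> cancels them in the next
    step.\<close>
  have "(a \<ominus> b) \<otimes> (a \<oplus> b) = a \<otimes> a \<oplus> (a \<otimes> b \<ominus> a \<otimes> b) \<ominus> b \<otimes> b"
    using assms by algebra
  also have "\<dots> = a \<otimes> a \<ominus> b \<otimes> b"
    using assms by (simp add: minus_eq r_neg)
  finally show ?thesis
    using assms by (simp add: numeral_2_eq_2)
qed

lemma (in cring) half_sum_diff:
  assumes "\<one> \<oplus> \<one> \<in> Units R" "x \<in> carrier R" "y \<in> carrier R"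
  obtains a b where "a \<in> carrier R" "b \<in> carrier R" "a \<oplus> b = x" "a \<ominus> b = y"
proof -
  define u where "u = inv (\<one> \<oplus> \<one>)"
  have u: "u \<in> carrier R" "u \<otimes> (\<one> \<oplus> \<one>) = \<one>"
    using assms(1) by (simp_all add: u_def)
  \<comment> \<open>With the factor \<open>u \<otimes> (\<one> \<oplus> \<one>)\<close> kept whole,
    both equations are polynomial identities in \<open>u\<close>, \<open>x\<close>,
    \<open>y\<close>; that \<open>u\<close> is one half enters only in the last step.\<close>
  have "u \<otimes> (x \<oplus> y) \<oplus> u \<otimes> (x \<ominus> y) = (u \<otimes> (\<one> \<oplus> \<one>)) \<otimes> x"
    using u(1) assms(2,3) by algebra
  moreover have "u \<otimes> (x \<oplus> y) \<ominus> u \<otimes> (x \<ominus> y) = (u \<otimes> (\<one> \<oplus> \<one>)) \<otimes> y"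
    using u(1) assms(2,3) by algebra
  ultimately show thesis
    using that[of "u \<otimes> (x \<oplus> y)" "u \<otimes> (x \<ominus> y)"] u assms(2,3) by simp
qed

lemma (in cring) primeideal_imp_sdf_absorbing:
  assumes "primeideal J R"
  shows "sdf_absorbing J R"
proof -
  interpret J: primeideal J R by fact
  show ?thesis
    unfolding sdf_absorbing_def
    using J.is_ideal by (auto simp: diff_squares dest: J.I_prime[rotated 2])
qed

text \<open>Radicality enters only through \<open>sq\<close>, which handles a vanishing
  \<open>a\<close> or \<open>b\<close>. Since \<open>sdf_absorbing\<close> admits the whole ring,
  \<open>proper\<close> excludes it.\<close>

lemma (in cring) sdf_absorbing_imp_primeideal:
  assumes two: "\<one> \<oplus> \<one> \<in> Units R"
    and sdf: "sdf_absorbing J R"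
    and proper: "carrier R \<noteq> J"
    and sq: "\<And>x. x \<in> carrier R \<Longrightarrow> x \<otimes> x \<in> J \<Longrightarrow> x \<in> J"
  shows "primeideal J R"
proof -
  interpret J: ideal J R
    using sdf by (simp add: sdf_absorbing_def)
  show ?thesis
  proof (rule primeidealI[OF J.is_ideal is_cring proper])
    fix x y
    assume x: "x \<in> carrier R" and y: "y \<in> carrier R" and xy: "x \<otimes> y \<in> J"
    obtain a b where a: "a \<in> carrier R" and b: "b \<in> carrier R"
      and ab: "a \<oplus> b = x" "a \<ominus> b = y"
      using half_sum_diff[OF two x y] .
    consider "a = \<zero>" | "b = \<zero>" | "a \<noteq> \<zero>" "b \<noteq> \<zero>" by blast
    then show "x \<in> J \<or> y \<in> J"
    proof cases
      case 1
      then have "y = \<ominus> x"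
        using ab b by (auto simp: minus_eq)
      then have "x \<otimes> x = \<ominus> (x \<otimes> y)"
        using x by (simp add: r_minus)
      then show ?thesis
        using sq[OF x] xy J.a_inv_closed by simp
    next
      case 2
      then have "x = y"
        using ab a by (auto simp: minus_eq)
      then show ?thesis
        using sq[OF x] xy by simp
    next
      case 3
      have "a [^] (2::nat) \<ominus> b [^] (2::nat) = x \<otimes> y"
        using diff_squares[OF a b] ab x y by (simp add: m_comm)
      then have "a \<ominus> b \<in> J \<or> a \<oplus> b \<in> J"
        using sdf 3 a b xy unfolding sdf_absorbing_def by simp
      then show ?thesis
        using ab by auto
    qed
  qed
qed

text \<open>Doubling the exponent that witnesses membership of the square gives one for
  \<open>x\<close>. This supplies \<open>sq\<close> above.\<close>

lemma (in cring) radical_ideal_square: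
  assumes "x \<in> carrier R" "x \<otimes> x \<in> radical_ideal R I"
  shows "x \<in> radical_ideal R I"
proof -
  obtain n :: nat where n: "0 < n" "(x \<otimes> x) [^] n \<in> I"
    using assms(2) by (auto simp: radical_ideal_def)
  have "(x \<otimes> x) [^] n = x [^] (n + n)"
    using assms(1) by (simp add: nat_pow_distrib nat_pow_mult)
  then show ?thesis
    using n assms(1) by (auto simp: radical_ideal_def intro!: exI[of _ "n + n"])
qed

text \<open>This supplies \<open>proper\<close>: all powers of \<open>\<one>\<close> equal
  \<open>\<one>\<close>, so a radical containing it forces \<open>\<one> \<in> I\<close>.\<close>

lemma (in cring) radical_ideal_proper:
  assumes "proper_ideal I R"
  shows "carrier R \<noteq> radical_ideal R I"
proof
  assume "carrier R = radical_ideal R I"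
  then have "\<one> \<in> radical_ideal R I"
    using one_closed by simp
  then have "\<one> \<in> I"
    by (auto simp: radical_ideal_def)
  then show False
    using assms ideal.one_imp_carrier by (auto simp: proper_ideal_def)
qed

theorem proposition2p1:
  fixes R (structure) and I :: "'a set"
  assumes "cring R"
    and "\<one> \<oplus> \<one> \<in> Units R"
    and "proper_ideal I R"
  shows "quasi_sdf_absorbing I R \<longleftrightarrow> quasi_primary I R"
proof -
  interpret cring R by fact
  show ?thesis
    \<comment> \<open>Both sides share \<open>proper_ideal I R\<close>, and each carries in its
      definition that the radical is an ideal.\<close>
    unfolding quasi_sdf_absorbing_def quasi_primary_def
    using primeideal_imp_sdf_absorbing
      sdf_absorbing_imp_primeideal[OF assms(2) _ radical_ideal_proper[OF assms(3)]
        radical_ideal_square]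
    by blast
qed

end
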